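(* Let $n\geq1$, let $\tau$ be a triangular norm without zero divisors (equivalently, without nilpotent elements), and let $\mathbb{X}_1=\langle X_1;\mu_{X_1}\rangle,\dots,\mathbb{X}_n=\langle X_n;\mu_{X_n}\rangle$ be distributive (respectively, modular) fuzzy lattices. Then $\langle\prod_{i=1}^n X_i;\mu_p\rangle$, where $\mu_p((x_1,\dots,x_n),(y_1,\dots,y_n))=\tau^{(n)}(\mu_{X_1}(x_1,y_1),\dots,\mu_{X_n}(x_n,y_n))$, is a distributive (respectively, modular) fuzzy lattice.
   Context: A fuzzy relation on a set $X$ is a map $\mu\colon X\times X\to[0,1]$; it is reflexive if $\mu(x,x)=1$; transitive if $\mu(x,y)>0$ and $\mu(y,z)>0$ imply $\mu(x,z)>0$; anti-symmetric if $\mu(x,y)>0$ and $\mu(y,x)>0$ imply $x=y$. A fuzzy poset is $\langle X;\mu\rangle$ with $\mu$ reflexive, transitive, anti-symmetric. For $Y\subseteq X$: $x$ is a fuzzy lower (upper) bound of $Y$ if $\mu(x,y)>0$ (resp. $\mu(y,x)>0$) for all $y\in Y$; a fuzzy lower bound $x_0$ of $Y$ is its fuzzy meet if $\mu(x,x_0)>0$ for every fuzzy lower bound $x$; a fuzzy upper bound $x_0$ is its fuzzy join if $\mu(x_0,x)>0$ for every fuzzy upper bound $x$. Write $x\odot y$, $x\oplus y$ for the fuzzy meet and join of $\{x,y\}$. A fuzzy lattice is a fuzzy poset in which all $x\odot y$, $x\oplus y$ exist. It is distributive if $x\odot(y\oplus z)=(x\odot y)\oplus(x\odot z)$ and $x\oplus(y\odot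 z)=(x\oplus y)\odot(x\oplus z)$ for all $x,y,z$; it is modular if $(x\odot y)\oplus(z\odot y)=((x\odot y)\oplus z)\odot y$ for all $x,y,z$. A triangular norm is a map $\tau\colon[0,1]^2\to[0,1]$ that is associative, commutative, monotone in each argument and satisfies $\tau(a,1)=a$; it has zero divisors if $\tau(a,b)=0$ for some $a,b\in(0,1)$. Its $n$-ary extension: $\tau^{(1)}(a_1)=a_1$, $\tau^{(n)}(a_1,\dots,a_n)=\tau(\tau^{(n-1)}(a_1,\dots,a_{n-1}),a_n)$; $a\in(0,1)$ is nilpotent if $\tau^{(m)}(a,\dots,a)=0$ for some positive integer $m$. *)

theory Defs
  imports Complex_Main "HOL-Library.FuncSet"
begin

definition fuzzy_relation_on :: "'a set \<Rightarrow> ('a \<Rightarrow> 'a \<Rightarrow> real) \<Rightarrow> bool" where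
  "fuzzy_relation_on X \<mu> \<longleftrightarrow> (\<forall>x\<in>X. \<forall>y\<in>X. \<mu> x y \<in> {0..1})"

definition fuzzy_reflexive_on :: "'a set \<Rightarrow> ('a \<Rightarrow> 'a \<Rightarrow> real) \<Rightarrow> bool" where
  "fuzzy_reflexive_on X \<mu> \<longleftrightarrow> (\<forall>x\<in>X. \<mu> x x = 1)"

definition fuzzy_transitive_on :: "'a set \<Rightarrow> ('a \<Rightarrow> 'a \<Rightarrow> real) \<Rightarrow> bool" where
  "fuzzy_transitive_on X \<mu> \<longleftrightarrow>
     (\<forall>x\<in>X. \<forall>y\<in>X. \<forall>z\<in>X. \<mu> x y > 0 \<and> \<mu> y z > 0 \<longrightarrow> \<mu> x z > 0)"

definition fuzzy_antisymmetric_on :: "'a set \<Rightarrow> ('a \<Rightarrow> 'a \<Rightarrow> real) \<Rightarrow> bool" where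
  "fuzzy_antisymmetric_on X \<mu> \<longleftrightarrow>
     (\<forall>x\<in>X. \<forall>y\<in>X. \<mu> x y > 0 \<and> \<mu> y x > 0 \<longrightarrow> x = y)"

definition fuzzy_poset :: "'a set \<Rightarrow> ('a \<Rightarrow> 'a \<Rightarrow> real) \<Rightarrow> bool" where
  "fuzzy_poset X \<mu> \<longleftrightarrow> fuzzy_relation_on X \<mu> \<and> fuzzy_reflexive_on X \<mu> \<and>
     fuzzy_transitive_on X \<mu> \<and> fuzzy_antisymmetric_on X \<mu>"

definition fuzzy_lower_bound :: "'a set \<Rightarrow> ('a \<Rightarrow> 'a \<Rightarrow> real) \<Rightarrow> 'a set \<Rightarrow> 'a \<Rightarrow> bool" where
  "fuzzy_lower_bound X \<mu> Y x \<longleftrightarrow> x \<in> X \<and> (\<forall>y\<in>Y. \<mu> x y > 0)"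

definition fuzzy_upper_bound :: "'a set \<Rightarrow> ('a \<Rightarrow> 'a \<Rightarrow> real) \<Rightarrow> 'a set \<Rightarrow> 'a \<Rightarrow> bool" where
  "fuzzy_upper_bound X \<mu> Y x \<longleftrightarrow> x \<in> X \<and> (\<forall>y\<in>Y. \<mu> y x > 0)"

definition is_fuzzy_meet :: "'a set \<Rightarrow> ('a \<Rightarrow> 'a \<Rightarrow> real) \<Rightarrow> 'a set \<Rightarrow> 'a \<Rightarrow> bool" where
  "is_fuzzy_meet X \<mu> Y x0 \<longleftrightarrow> fuzzy_lower_bound X \<mu> Y x0 \<and>
     (\<forall>x. fuzzy_lower_bound X \<mu> Y x \<longrightarrow> \<mu> x x0 > 0)"

definition is_fuzzy_join :: "'a set \<Rightarrow> ('a \<Rightarrow> 'a \<Rightarrow> real) \<Rightarrow> 'a set \<Rightarrow> 'a \<Rightarrow> bool" where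
  "is_fuzzy_join X \<mu> Y x0 \<longleftrightarrow> fuzzy_upper_bound X \<mu> Y x0 \<and>
     (\<forall>x. fuzzy_upper_bound X \<mu> Y x \<longrightarrow> \<mu> x0 x > 0)"

definition fuzzy_meet :: "'a set \<Rightarrow> ('a \<Rightarrow> 'a \<Rightarrow> real) \<Rightarrow> 'a \<Rightarrow> 'a \<Rightarrow> 'a" where
  "fuzzy_meet X \<mu> x y = (THE m. is_fuzzy_meet X \<mu> {x, y} m)"

definition fuzzy_join :: "'a set \<Rightarrow> ('a \<Rightarrow> 'a \<Rightarrow> real) \<Rightarrow> 'a \<Rightarrow> 'a \<Rightarrow> 'a" where
  "fuzzy_join X \<mu> x y = (THE j. is_fuzzy_join X \<mu> {x, y} j)"

definition fuzzy_lattice :: "'a set \<Rightarrow> ('a \<Rightarrow> 'a \<Rightarrow> real) \<Rightarrow> bool" where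
  "fuzzy_lattice X \<mu> \<longleftrightarrow> fuzzy_poset X \<mu> \<and>
     (\<forall>x\<in>X. \<forall>y\<in>X. (\<exists>m. is_fuzzy_meet X \<mu> {x, y} m) \<and> (\<exists>j. is_fuzzy_join X \<mu> {x, y} j))"

definition distributive_fuzzy_lattice :: "'a set \<Rightarrow> ('a \<Rightarrow> 'a \<Rightarrow> real) \<Rightarrow> bool" where
  "distributive_fuzzy_lattice X \<mu> \<longleftrightarrow> fuzzy_lattice X \<mu> \<and>
     (\<forall>x\<in>X. \<forall>y\<in>X. \<forall>z\<in>X.
        fuzzy_meet X \<mu> x (fuzzy_join X \<mu> y z) =
          fuzzy_join X \<mu> (fuzzy_meet X \<mu> x y) (fuzzy_meet X \<mu> x z) \<and>
        fuzzy_join X \<mu> x (fuzzy_meet X \<mu> y z) =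
          fuzzy_meet X \<mu> (fuzzy_join X \<mu> x y) (fuzzy_join X \<mu> x z))"

definition modular_fuzzy_lattice :: "'a set \<Rightarrow> ('a \<Rightarrow> 'a \<Rightarrow> real) \<Rightarrow> bool" where
  "modular_fuzzy_lattice X \<mu> \<longleftrightarrow> fuzzy_lattice X \<mu> \<and>
     (\<forall>x\<in>X. \<forall>y\<in>X. \<forall>z\<in>X.
        fuzzy_join X \<mu> (fuzzy_meet X \<mu> x y) (fuzzy_meet X \<mu> z y) =
          fuzzy_meet X \<mu> (fuzzy_join X \<mu> (fuzzy_meet X \<mu> x y) z) y)"

definition triangular_norm :: "(real \<Rightarrow> real \<Rightarrow> real) \<Rightarrow> bool" where
  "triangular_norm \<tau> \<longleftrightarrow>
     (\<forall>a\<in>{0..1}. \<forall>b\<in>{0..1}. \<tau> a b \<in> {0..1}) \<and>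
     (\<forall>a\<in>{0..1}. \<forall>b\<in>{0..1}. \<forall>c\<in>{0..1}. \<tau> (\<tau> a b) c = \<tau> a (\<tau> b c)) \<and>
     (\<forall>a\<in>{0..1}. \<forall>b\<in>{0..1}. \<tau> a b = \<tau> b a) \<and>
     (\<forall>a\<in>{0..1}. \<forall>a'\<in>{0..1}. \<forall>b\<in>{0..1}. a \<le> a' \<longrightarrow> \<tau> a b \<le> \<tau> a' b \<and> \<tau> b a \<le> \<tau> b a') \<and>
     (\<forall>a\<in>{0..1}. \<tau> a 1 = a)"

definition has_zero_divisors :: "(real \<Rightarrow> real \<Rightarrow> real) \<Rightarrow> bool" where
  "has_zero_divisors \<tau> \<longleftrightarrow> (\<exists>a\<in>{0<..<1}. \<exists>b\<in>{0<..<1}. \<tau> a b = 0)"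

text \<open>The arguments are \<open>a 1, \<dots>, a n\<close>; the value for \<open>n = 0\<close> is a mere convention.\<close>

fun tnorm_ext :: "(real \<Rightarrow> real \<Rightarrow> real) \<Rightarrow> nat \<Rightarrow> (nat \<Rightarrow> real) \<Rightarrow> real" where
  "tnorm_ext \<tau> 0 a = 1"
| "tnorm_ext \<tau> (Suc 0) a = a 1"
| "tnorm_ext \<tau> (Suc (Suc n)) a = \<tau> (tnorm_ext \<tau> (Suc n) a) (a (Suc (Suc n)))"

definition nilpotent_element :: "(real \<Rightarrow> real \<Rightarrow> real) \<Rightarrow> real \<Rightarrow> bool" where
  "nilpotent_element \<tau> a \<longleftrightarrow> a \<in> {0<..<1} \<and> (\<exists>m\<ge>1. tnorm_ext \<tau> m (\<lambda>_. a) = 0)"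

definition product_fuzzy_relation ::
  "(real \<Rightarrow> real \<Rightarrow> real) \<Rightarrow> nat \<Rightarrow> (nat \<Rightarrow> 'a \<Rightarrow> 'a \<Rightarrow> real) \<Rightarrow> (nat \<Rightarrow> 'a) \<Rightarrow> (nat \<Rightarrow> 'a) \<Rightarrow> real" where
  "product_fuzzy_relation \<tau> n \<mu> x y = tnorm_ext \<tau> n (\<lambda>i. \<mu> i (x i) (y i))"

text \<open>Meets and joins are unique in a fuzzy poset, so the definite descriptions in
  \<open>fuzzy_meet\<close> and \<open>fuzzy_join\<close> denote them whenever they exist.\<close>

lemma fuzzy_meet_eqI:
  assumes "fuzzy_poset X \<mu>" "is_fuzzy_meet X \<mu> {x, y} m"
  shows "fuzzy_meet X \<mu> x y = m"
  unfolding fuzzy_meet_def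
proof (rule the_equality)
  show "is_fuzzy_meet X \<mu> {x, y} m" by fact
  fix m' assume "is_fuzzy_meet X \<mu> {x, y} m'"
  then show "m' = m" using assms
    unfolding is_fuzzy_meet_def fuzzy_poset_def fuzzy_antisymmetric_on_def fuzzy_lower_bound_def
    by blast
qed

lemma fuzzy_join_eqI:
  assumes "fuzzy_poset X \<mu>" "is_fuzzy_join X \<mu> {x, y} j"
  shows "fuzzy_join X \<mu> x y = j"
  unfolding fuzzy_join_def
proof (rule the_equality)
  show "is_fuzzy_join X \<mu> {x, y} j" by fact
  fix j' assume "is_fuzzy_join X \<mu> {x, y} j'"
  then show "j' = j" using assms
    unfolding is_fuzzy_join_def fuzzy_poset_def fuzzy_antisymmetric_on_def fuzzy_upper_bound_def
    by blast
qed

end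

theory Submission imports Defs begin

text \<open>Without zero divisors, \<open>\<tau>\<^sup>(\<^sup>n\<^sup>)(a\<^sub>1, \<dots>, a\<^sub>n)\<close> is positive exactly when every \<open>a\<^sub>i\<close> is.
  Since the order-theoretic notions only see the crisp relation \<open>\<mu> x y > 0\<close>, the product is then
  ordered componentwise, so meets and joins are taken componentwise and every lattice identity is
  inherited. A zero divisor \<open>\<tau> a b = 0\<close> yields the nilpotent element \<open>min a b\<close>.\<close>

section \<open>Triangular norms on pairs\<close>

lemma triangular_norm_closed:
  assumes "triangular_norm \<tau>" "a \<in> {0..1}" "b \<in> {0..1}"
  shows "\<tau> a b \<in> {0..1}"
  using assms unfolding triangular_norm_def by blast

lemma triangular_norm_commute:
  assumes "triangular_norm \<tau>" "a \<in> {0..1}" "b \<in> {0..1}"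
  shows "\<tau> a b = \<tau> b a"
  using assms unfolding triangular_norm_def by blast

lemma triangular_norm_mono:
  assumes "triangular_norm \<tau>" "a \<in> {0..1}" "a' \<in> {0..1}" "b \<in> {0..1}" "b' \<in> {0..1}"
    and "a \<le> a'" "b \<le> b'"
  shows "\<tau> a b \<le> \<tau> a' b'"
proof -
  have "\<tau> a b \<le> \<tau> a' b" "\<tau> a' b \<le> \<tau> a' b'"
    using assms unfolding triangular_norm_def by blast+
  then show ?thesis by simp
qed

lemma triangular_norm_one_right:
  assumes "triangular_norm \<tau>" "a \<in> {0..1}"
  shows "\<tau> a 1 = a"
  using assms unfolding triangular_norm_def by blast

text \<open>Raising the second argument to the neutral element 1 can only increase the
  value.\<close>

lemma triangular_norm_le_left:
  assumes "triangular_norm \<tau>" "a \<in> {0..1}" "b \<in> {0..1}"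
  shows "\<tau> a b \<le> a"
  using triangular_norm_mono[OF assms(1,2,2,3), of 1] triangular_norm_one_right[OF assms(1,2)] assms(3)
  by simp

text \<open>A positive value forces positive arguments because \<open>\<tau>\<close> lies below each
  of them. The converse is the absence of zero divisors, extended from the open interval to the
  endpoint 1.\<close>

lemma triangular_norm_pos_iff:
  assumes \<tau>: "triangular_norm \<tau>" and nz: "\<not> has_zero_divisors \<tau>"
    and a: "a \<in> {0..1}" and b: "b \<in> {0..1}"
  shows "\<tau> a b > 0 \<longleftrightarrow> a > 0 \<and> b > 0"
proof
  assume "\<tau> a b > 0"
  then show "a > 0 \<and> b > 0"
    using triangular_norm_le_left[OF \<tau> a b] triangular_norm_le_left[OF \<tau> b a]
      triangular_norm_commute[OF \<tau> a b] by linarith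
next
  assume pos: "a > 0 \<and> b > 0"
  \<comment> \<open>\<open>has_zero_divisors\<close> speaks only of arguments strictly below 1; an
    argument equal to 1 is handled by neutrality.\<close>
  consider "a = 1" | "b = 1" | "a \<in> {0<..<1}" "b \<in> {0<..<1}"
    using pos a b by fastforce
  then show "\<tau> a b > 0"
  proof cases
    case 1
    then show ?thesis
      using pos triangular_norm_commute[OF \<tau> a b] triangular_norm_one_right[OF \<tau> b] by simp
  next
    case 2
    then show ?thesis using pos triangular_norm_one_right[OF \<tau> a] by simp
  next
    case 3
    then have "\<tau> a b \<noteq> 0" using nz unfolding has_zero_divisors_def by blast
    then show ?thesis using triangular_norm_closed[OF \<tau> a b] by auto
  qed
qed

section \<open>The n-ary extension and nilpotent elements\<close>

lemma tnorm_ext_closed: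
  assumes "triangular_norm \<tau>" "\<forall>i\<in>{1..n}. a i \<in> {0..1}"
  shows "tnorm_ext \<tau> n a \<in> {0..1}"
  using assms
proof (induction \<tau> n a rule: tnorm_ext.induct)
  case (3 \<tau> n a)
  then have "tnorm_ext \<tau> (Suc n) a \<in> {0..1}" "a (Suc (Suc n)) \<in> {0..1}" by auto
  then show ?case using triangular_norm_closed[OF 3(2)] by simp
qed auto

text \<open>Induction along the recursion of \<open>tnorm_ext\<close>, splitting off the last
  argument. For \<open>n = 0\<close> the conventional value 1 agrees with the empty
  conjunction.\<close>

lemma tnorm_ext_pos_iff:
  assumes "triangular_norm \<tau>" "\<not> has_zero_divisors \<tau>" "\<forall>i\<in>{1..n}. a i \<in> {0..1}"
  shows "tnorm_ext \<tau> n a > 0 \<longleftrightarrow> (\<forall>i\<in>{1..n}. a i > 0)"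
  using assms
proof (induction \<tau> n a rule: tnorm_ext.induct)
  case (3 \<tau> n a)
  have "tnorm_ext \<tau> (Suc n) a \<in> {0..1}" "a (Suc (Suc n)) \<in> {0..1}"
    using 3(4) tnorm_ext_closed[OF 3(2), of "Suc n" a] by auto
  moreover have "tnorm_ext \<tau> (Suc n) a > 0 \<longleftrightarrow> (\<forall>i\<in>{1..Suc n}. a i > 0)"
    using 3 by auto
  ultimately show ?case
    using triangular_norm_pos_iff[OF 3(2,3)] by (auto simp: le_Suc_eq)
qed auto

text \<open>Reflexivity of the product relation asks for the exact value 1, which positivity alone
  does not give.\<close>

lemma tnorm_ext_eq_one:
  assumes "triangular_norm \<tau>" "\<forall>i\<in>{1..n}. a i = 1"
  shows "tnorm_ext \<tau> n a = 1"
  using assms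
  by (induction \<tau> n a rule: tnorm_ext.induct) (auto simp: triangular_norm_one_right)

text \<open>By monotonicity the smaller of two zero divisors already has square 0. Conversely,
  without zero divisors all powers of a positive element stay positive, so none of them
  vanishes.\<close>

lemma has_zero_divisors_iff_nilpotent_element:
  assumes \<tau>: "triangular_norm \<tau>"
  shows "has_zero_divisors \<tau> \<longleftrightarrow> (\<exists>a. nilpotent_element \<tau> a)"
proof
  assume "has_zero_divisors \<tau>"
  then obtain a b where ab: "a \<in> {0<..<1}" "b \<in> {0<..<1}" "\<tau> a b = 0"
    unfolding has_zero_divisors_def by blast
  define c where "c = min a b"
  have c: "c \<in> {0<..<1}" using ab by (auto simp: c_def)
  have "\<tau> c c \<le> \<tau> a b"
    using ab c by (intro triangular_norm_mono[OF \<tau>]) (auto simp: c_def)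
  moreover have "\<tau> c c \<in> {0..1}" using c by (intro triangular_norm_closed[OF \<tau>]) auto
  \<comment> \<open>Writing 2 as \<open>Suc (Suc 0)\<close> lets the recursion equations reduce the
    left-hand side to \<open>\<tau> c c\<close>.\<close>
  ultimately have "tnorm_ext \<tau> 2 (\<lambda>_. c) = 0" using ab(3) by (simp add: numeral_2_eq_2)
  then have "nilpotent_element \<tau> c"
    using c unfolding nilpotent_element_def by (intro conjI exI[of _ 2]) auto
  then show "\<exists>a. nilpotent_element \<tau> a" ..
next
  assume "\<exists>a. nilpotent_element \<tau> a"
  then obtain a m where am: "a \<in> {0<..<1}" "tnorm_ext \<tau> m (\<lambda>_. a) = 0"
    unfolding nilpotent_element_def by blast
  show "has_zero_divisors \<tau>"
  proof (rule ccontr)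
    assume "\<not> has_zero_divisors \<tau>"
    then show False using tnorm_ext_pos_iff[OF \<tau>, of m "\<lambda>_. a"] am by auto
  qed
qed

section \<open>Order duality, which transfers statements about meets to joins\<close>

lemma fuzzy_poset_dual:
  "fuzzy_poset X (\<lambda>x y. \<mu> y x) \<longleftrightarrow> fuzzy_poset X \<mu>"
  unfolding fuzzy_poset_def fuzzy_relation_on_def fuzzy_reflexive_on_def
    fuzzy_transitive_on_def fuzzy_antisymmetric_on_def
  by blast

lemma is_fuzzy_meet_dual:
  "is_fuzzy_meet X (\<lambda>x y. \<mu> y x) = is_fuzzy_join X \<mu>"
  unfolding is_fuzzy_meet_def is_fuzzy_join_def fuzzy_lower_bound_def fuzzy_upper_bound_def ..

lemma is_fuzzy_join_dual:
  "is_fuzzy_join X (\<lambda>x y. \<mu> y x) = is_fuzzy_meet X \<mu>"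
  unfolding is_fuzzy_meet_def is_fuzzy_join_def fuzzy_lower_bound_def fuzzy_upper_bound_def ..

lemma fuzzy_meet_dual:
  "fuzzy_meet X (\<lambda>x y. \<mu> y x) = fuzzy_join X \<mu>"
  \<comment> \<open>The relation is instantiated here and in later uses of duality because, as a
    higher-order pattern, \<open>\<lambda>x y. \<mu> y x\<close> matches every relation.\<close>
  unfolding fuzzy_meet_def fuzzy_join_def is_fuzzy_meet_dual[of X \<mu>] ..

lemma fuzzy_lattice_dual:
  "fuzzy_lattice X (\<lambda>x y. \<mu> y x) \<longleftrightarrow> fuzzy_lattice X \<mu>"
  unfolding fuzzy_lattice_def fuzzy_poset_dual[of X \<mu>] is_fuzzy_meet_dual[of X \<mu>]
    is_fuzzy_join_dual[of X \<mu>] by blast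

text \<open>The lattice property supplies a meet, and uniqueness identifies it with the definite
  description.\<close>

lemma is_fuzzy_meet_fuzzy_meet:
  assumes "fuzzy_lattice X \<mu>" "x \<in> X" "y \<in> X"
  shows "is_fuzzy_meet X \<mu> {x, y} (fuzzy_meet X \<mu> x y)"
  using assms fuzzy_meet_eqI[of X \<mu> x y] unfolding fuzzy_lattice_def by metis

lemma fuzzy_meet_closed:
  assumes "fuzzy_lattice X \<mu>" "x \<in> X" "y \<in> X"
  shows "fuzzy_meet X \<mu> x y \<in> X"
  using is_fuzzy_meet_fuzzy_meet[OF assms]
  by (simp add: is_fuzzy_meet_def fuzzy_lower_bound_def)

lemma fuzzy_join_closed:
  assumes "fuzzy_lattice X \<mu>" "x \<in> X" "y \<in> X"
  shows "fuzzy_join X \<mu> x y \<in> X"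
  using fuzzy_meet_closed[of X "\<lambda>x y. \<mu> y x"] assms
  by (simp add: fuzzy_lattice_dual[of X \<mu>] fuzzy_meet_dual[of X \<mu>])

section \<open>Products of fuzzy posets and fuzzy lattices\<close>

lemma product_fuzzy_relation_dual:
  "product_fuzzy_relation \<tau> n (\<lambda>i x y. \<mu> i y x) = (\<lambda>x y. product_fuzzy_relation \<tau> n \<mu> y x)"
  by (simp add: product_fuzzy_relation_def fun_eq_iff)

text \<open>In the product construction, the absence of zero divisors enters through this
  equivalence.\<close>

lemma product_fuzzy_relation_pos_iff:
  assumes "triangular_norm \<tau>" "\<not> has_zero_divisors \<tau>"
    and "\<forall>i\<in>{1..n}. fuzzy_relation_on (X i) (\<mu> i)"
    and "x \<in> (\<Pi>\<^sub>E i\<in>{1..n}. X i)" "y \<in> (\<Pi>\<^sub>E i\<in>{1..n}. X i)"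
  shows "product_fuzzy_relation \<tau> n \<mu> x y > 0 \<longleftrightarrow> (\<forall>i\<in>{1..n}. \<mu> i (x i) (y i) > 0)"
  unfolding product_fuzzy_relation_def
  using assms(3-5) unfolding fuzzy_relation_on_def
  by (intro tnorm_ext_pos_iff[OF assms(1,2)]) (blast dest: PiE_mem)

text \<open>Transitivity and antisymmetry depend only on positivity and reduce to the factors
  through \<open>iff\<close>; the range condition and reflexivity concern actual values and come
  from the properties of \<open>tnorm_ext\<close>.\<close>

lemma fuzzy_poset_product:
  assumes \<tau>: "triangular_norm \<tau>" and nz: "\<not> has_zero_divisors \<tau>"
    and pos: "\<forall>i\<in>{1..n}. fuzzy_poset (X i) (\<mu> i)"
  shows "fuzzy_poset (\<Pi>\<^sub>E i\<in>{1..n}. X i) (product_fuzzy_relation \<tau> n \<mu>)"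
proof -
  have rel: "\<forall>i\<in>{1..n}. fuzzy_relation_on (X i) (\<mu> i)"
    using pos by (simp add: fuzzy_poset_def)
  note iff = product_fuzzy_relation_pos_iff[OF \<tau> nz rel]
  show ?thesis
    unfolding fuzzy_poset_def
  proof (intro conjI)
    show "fuzzy_relation_on (\<Pi>\<^sub>E i\<in>{1..n}. X i) (product_fuzzy_relation \<tau> n \<mu>)"
      using rel unfolding fuzzy_relation_on_def product_fuzzy_relation_def
      by (intro ballI tnorm_ext_closed[OF \<tau>]) (blast dest: PiE_mem)
    show "fuzzy_reflexive_on (\<Pi>\<^sub>E i\<in>{1..n}. X i) (product_fuzzy_relation \<tau> n \<mu>)"
      using pos
      unfolding fuzzy_poset_def fuzzy_reflexive_on_def product_fuzzy_relation_def
      by (intro ballI tnorm_ext_eq_one[OF \<tau>]) (blast dest: PiE_mem)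
    show "fuzzy_transitive_on (\<Pi>\<^sub>E i\<in>{1..n}. X i) (product_fuzzy_relation \<tau> n \<mu>)"
      unfolding fuzzy_transitive_on_def
    proof (intro ballI impI, elim conjE)
      fix x y z
      assume mem: "x \<in> (\<Pi>\<^sub>E i\<in>{1..n}. X i)" "y \<in> (\<Pi>\<^sub>E i\<in>{1..n}. X i)" "z \<in> (\<Pi>\<^sub>E i\<in>{1..n}. X i)"
        and "product_fuzzy_relation \<tau> n \<mu> x y > 0" "product_fuzzy_relation \<tau> n \<mu> y z > 0"
      then have "\<forall>i\<in>{1..n}. \<mu> i (x i) (y i) > 0 \<and> \<mu> i (y i) (z i) > 0"
        by (simp add: iff)
      then have "\<forall>i\<in>{1..n}. \<mu> i (x i) (z i) > 0"
        using pos mem[THEN PiE_mem] unfolding fuzzy_poset_def fuzzy_transitive_on_def by blast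
      then show "product_fuzzy_relation \<tau> n \<mu> x z > 0" using mem by (simp add: iff)
    qed
    show "fuzzy_antisymmetric_on (\<Pi>\<^sub>E i\<in>{1..n}. X i) (product_fuzzy_relation \<tau> n \<mu>)"
      unfolding fuzzy_antisymmetric_on_def
    proof (intro ballI impI, elim conjE)
      fix x y
      assume mem: "x \<in> (\<Pi>\<^sub>E i\<in>{1..n}. X i)" "y \<in> (\<Pi>\<^sub>E i\<in>{1..n}. X i)"
        and "product_fuzzy_relation \<tau> n \<mu> x y > 0" "product_fuzzy_relation \<tau> n \<mu> y x > 0"
      then have le: "\<forall>i\<in>{1..n}. \<mu> i (x i) (y i) > 0 \<and> \<mu> i (y i) (x i) > 0"
        by (simp add: iff)
      show "x = y"
      \<comment> \<open>Members of the extensional product agree outside \<open>{1..n}\<close>, so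
        antisymmetry in each factor suffices.\<close>
      proof (rule PiE_ext[OF mem])
        fix i assume "i \<in> {1..n}"
        then show "x i = y i"
          using pos le mem[THEN PiE_mem] unfolding fuzzy_poset_def fuzzy_antisymmetric_on_def
          by blast
      qed
    qed
  qed
qed

lemma is_fuzzy_meet_product:
  assumes \<tau>: "triangular_norm \<tau>" and nz: "\<not> has_zero_divisors \<tau>"
    and lat: "\<forall>i\<in>{1..n}. fuzzy_lattice (X i) (\<mu> i)"
    and x: "x \<in> (\<Pi>\<^sub>E i\<in>{1..n}. X i)" and y: "y \<in> (\<Pi>\<^sub>E i\<in>{1..n}. X i)"
  shows "is_fuzzy_meet (\<Pi>\<^sub>E i\<in>{1..n}. X i) (product_fuzzy_relation \<tau> n \<mu>) {x, y}
    (\<lambda>i\<in>{1..n}. fuzzy_meet (X i) (\<mu> i) (x i) (y i))"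
proof -
  \<comment> \<open>Restricting the abstraction to \<open>{1..n}\<close> makes the candidate
    extensional, as membership in the product requires.\<close>
  let ?m = "\<lambda>i\<in>{1..n}. fuzzy_meet (X i) (\<mu> i) (x i) (y i)"
  have rel: "\<forall>i\<in>{1..n}. fuzzy_relation_on (X i) (\<mu> i)"
    using lat by (simp add: fuzzy_poset_def fuzzy_lattice_def)
  note iff = product_fuzzy_relation_pos_iff[OF \<tau> nz rel]
  have meet: "is_fuzzy_meet (X i) (\<mu> i) {x i, y i} (?m i)" if "i \<in> {1..n}" for i
    using is_fuzzy_meet_fuzzy_meet lat that x[THEN PiE_mem, OF that] y[THEN PiE_mem, OF that] by fastforce
  then have m: "?m \<in> (\<Pi>\<^sub>E i\<in>{1..n}. X i)"
    unfolding is_fuzzy_meet_def fuzzy_lower_bound_def by (intro PiE_I) auto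
  show ?thesis
    unfolding is_fuzzy_meet_def
  proof (intro conjI allI impI)
    show "fuzzy_lower_bound (\<Pi>\<^sub>E i\<in>{1..n}. X i) (product_fuzzy_relation \<tau> n \<mu>) {x, y} ?m"
      using m meet iff[OF m x] iff[OF m y] unfolding is_fuzzy_meet_def fuzzy_lower_bound_def by blast
  next
    fix z assume "fuzzy_lower_bound (\<Pi>\<^sub>E i\<in>{1..n}. X i) (product_fuzzy_relation \<tau> n \<mu>) {x, y} z"
    then have z: "z \<in> (\<Pi>\<^sub>E i\<in>{1..n}. X i)"
      and le: "\<forall>i\<in>{1..n}. \<mu> i (z i) (x i) > 0" "\<forall>i\<in>{1..n}. \<mu> i (z i) (y i) > 0"
      using iff[OF _ x] iff[OF _ y] unfolding fuzzy_lower_bound_def by blast+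
    then have "\<mu> i (z i) (?m i) > 0" if "i \<in> {1..n}" for i
      using meet[OF that] le that z[THEN PiE_mem, OF that]
      unfolding is_fuzzy_meet_def fuzzy_lower_bound_def by blast
    then show "product_fuzzy_relation \<tau> n \<mu> z ?m > 0" using iff[OF z m] by blast
  qed
qed

text \<open>Reversing the relation of every factor reverses the product relation, so this is the
  meet statement for the reversed factors.\<close>

lemma is_fuzzy_join_product:
  assumes "triangular_norm \<tau>" "\<not> has_zero_divisors \<tau>"
    and "\<forall>i\<in>{1..n}. fuzzy_lattice (X i) (\<mu> i)"
    and "x \<in> (\<Pi>\<^sub>E i\<in>{1..n}. X i)" "y \<in> (\<Pi>\<^sub>E i\<in>{1..n}. X i)"
  shows "is_fuzzy_join (\<Pi>\<^sub>E i\<in>{1..n}. X i) (product_fuzzy_relation \<tau> n \<mu>) {x, y}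
    (\<lambda>i\<in>{1..n}. fuzzy_join (X i) (\<mu> i) (x i) (y i))"
  using is_fuzzy_meet_product[OF assms(1,2), of n X "\<lambda>i x y. \<mu> i y x" x y] assms(3-5)
  unfolding product_fuzzy_relation_dual[of \<tau> n \<mu>] fuzzy_lattice_dual[of "X i" "\<mu> i" for i]
    fuzzy_meet_dual[of "X i" "\<mu> i" for i]
    is_fuzzy_meet_dual[of _ "product_fuzzy_relation \<tau> n \<mu>"]
  by blast

lemma fuzzy_lattice_product:
  assumes "triangular_norm \<tau>" "\<not> has_zero_divisors \<tau>"
    and "\<forall>i\<in>{1..n}. fuzzy_lattice (X i) (\<mu> i)"
  shows "fuzzy_lattice (\<Pi>\<^sub>E i\<in>{1..n}. X i) (product_fuzzy_relation \<tau> n \<mu>)"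
  using fuzzy_poset_product[OF assms(1,2), of n X \<mu>]
    is_fuzzy_meet_product[OF assms] is_fuzzy_join_product[OF assms] assms(3)
  unfolding fuzzy_lattice_def by blast

lemma fuzzy_meet_product:
  assumes "triangular_norm \<tau>" "\<not> has_zero_divisors \<tau>"
    and "\<forall>i\<in>{1..n}. fuzzy_lattice (X i) (\<mu> i)"
    and "x \<in> (\<Pi>\<^sub>E i\<in>{1..n}. X i)" "y \<in> (\<Pi>\<^sub>E i\<in>{1..n}. X i)"
  shows "fuzzy_meet (\<Pi>\<^sub>E i\<in>{1..n}. X i) (product_fuzzy_relation \<tau> n \<mu>) x y =
    (\<lambda>i\<in>{1..n}. fuzzy_meet (X i) (\<mu> i) (x i) (y i))"
  using fuzzy_lattice_product[OF assms(1-3)] is_fuzzy_meet_product[OF assms]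
  unfolding fuzzy_lattice_def by (blast intro: fuzzy_meet_eqI)

lemma fuzzy_join_product:
  assumes "triangular_norm \<tau>" "\<not> has_zero_divisors \<tau>"
    and "\<forall>i\<in>{1..n}. fuzzy_lattice (X i) (\<mu> i)"
    and "x \<in> (\<Pi>\<^sub>E i\<in>{1..n}. X i)" "y \<in> (\<Pi>\<^sub>E i\<in>{1..n}. X i)"
  shows "fuzzy_join (\<Pi>\<^sub>E i\<in>{1..n}. X i) (product_fuzzy_relation \<tau> n \<mu>) x y =
    (\<lambda>i\<in>{1..n}. fuzzy_join (X i) (\<mu> i) (x i) (y i))"
  using fuzzy_lattice_product[OF assms(1-3)] is_fuzzy_join_product[OF assms]
  unfolding fuzzy_lattice_def by (blast intro: fuzzy_join_eqI)

section \<open>Inheritance of lattice identities by the product\<close>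

lemma distributive_fuzzy_lattice_product:
  assumes \<tau>: "triangular_norm \<tau>" "\<not> has_zero_divisors \<tau>"
    and dist: "\<forall>i\<in>{1..n}. distributive_fuzzy_lattice (X i) (\<mu> i)"
  shows "distributive_fuzzy_lattice (\<Pi>\<^sub>E i\<in>{1..n}. X i) (product_fuzzy_relation \<tau> n \<mu>)"
proof -
  have lat: "\<forall>i\<in>{1..n}. fuzzy_lattice (X i) (\<mu> i)"
    using dist by (simp add: distributive_fuzzy_lattice_def)
  note L = fuzzy_lattice_product[OF \<tau> lat]
  show ?thesis
    unfolding distributive_fuzzy_lattice_def
  proof (intro conjI ballI L)
    fix x y z
    assume mem: "x \<in> (\<Pi>\<^sub>E i\<in>{1..n}. X i)" "y \<in> (\<Pi>\<^sub>E i\<in>{1..n}. X i)" "z \<in> (\<Pi>\<^sub>E i\<in>{1..n}. X i)"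
    let ?M = "fuzzy_meet (\<Pi>\<^sub>E i\<in>{1..n}. X i) (product_fuzzy_relation \<tau> n \<mu>)"
    let ?J = "fuzzy_join (\<Pi>\<^sub>E i\<in>{1..n}. X i) (product_fuzzy_relation \<tau> n \<mu>)"
    note closed = fuzzy_meet_closed[OF L] fuzzy_join_closed[OF L]
    \<comment> \<open>At coordinate \<open>i\<close> both sides become the terms of the identity in
      the factor \<open>X i\<close>. The componentwise formulas hold for members of the product, so
      the inner meets and joins must be known to lie there.\<close>
    have "?M x (?J y z) i = ?J (?M x y) (?M x z) i \<and> ?J x (?M y z) i = ?M (?J x y) (?J x z) i"
      if "i \<in> {1..n}" for i
      using dist mem[THEN PiE_mem, OF that] that mem
        closed[OF mem(1,2)] closed[OF mem(1,3)] closed[OF mem(2,3)]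
      unfolding distributive_fuzzy_lattice_def
      \<comment> \<open>The deleted simp rules would rewrite the index set and membership in it;
        keeping \<open>i \<in> {1..n}\<close> intact lets the restricted abstractions and the
        hypotheses on the factors match.\<close>
      by (simp add: fuzzy_meet_product[OF \<tau> lat] fuzzy_join_product[OF \<tau> lat]
          del: One_nat_def atLeastAtMost_iff)
    then show "?M x (?J y z) = ?J (?M x y) (?M x z)" "?J x (?M y z) = ?M (?J x y) (?J x z)"
      by (intro PiE_ext[where k="{1..n}" and s=X] closed mem; blast)+
  qed
qed

lemma modular_fuzzy_lattice_product:
  assumes \<tau>: "triangular_norm \<tau>" "\<not> has_zero_divisors \<tau>"
    and modular: "\<forall>i\<in>{1..n}. modular_fuzzy_lattice (X i) (\<mu> i)"
  shows "modular_fuzzy_lattice (\<Pi>\<^sub>E i\<in>{1..n}. X i) (product_fuzzy_relation \<tau> n \<mu>)"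
proof -
  have lat: "\<forall>i\<in>{1..n}. fuzzy_lattice (X i) (\<mu> i)"
    using modular by (simp add: modular_fuzzy_lattice_def)
  note L = fuzzy_lattice_product[OF \<tau> lat]
  show ?thesis
    unfolding modular_fuzzy_lattice_def
  proof (intro conjI ballI L)
    fix x y z
    assume mem: "x \<in> (\<Pi>\<^sub>E i\<in>{1..n}. X i)" "y \<in> (\<Pi>\<^sub>E i\<in>{1..n}. X i)" "z \<in> (\<Pi>\<^sub>E i\<in>{1..n}. X i)"
    let ?M = "fuzzy_meet (\<Pi>\<^sub>E i\<in>{1..n}. X i) (product_fuzzy_relation \<tau> n \<mu>)"
    let ?J = "fuzzy_join (\<Pi>\<^sub>E i\<in>{1..n}. X i) (product_fuzzy_relation \<tau> n \<mu>)"
    note closed = fuzzy_meet_closed[OF L] fuzzy_join_closed[OF L]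
    have "?J (?M x y) (?M z y) i = ?M (?J (?M x y) z) y i" if "i \<in> {1..n}" for i
      using modular mem[THEN PiE_mem, OF that] that mem
        \<comment> \<open>\<open>closed(1)\<close> concerns meets and \<open>closed(2)\<close>
          joins; the last fact covers the join nested inside the outer meet of the modular
          identity.\<close>
        closed(1)[OF mem(1,2)] closed(1)[OF mem(3,2)] closed(2)[OF closed(1)[OF mem(1,2)] mem(3)]
      unfolding modular_fuzzy_lattice_def
      by (simp add: fuzzy_meet_product[OF \<tau> lat] fuzzy_join_product[OF \<tau> lat]
          del: One_nat_def atLeastAtMost_iff)
    then show "?J (?M x y) (?M z y) = ?M (?J (?M x y) z) y"
      by (intro PiE_ext[where k="{1..n}" and s=X] closed mem; blast)+
  qed
qed

text \<open>Tuples are encoded as extensional functions on \<open>{1..n}\<close>, with carriers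
  \<open>X i\<close> that may differ inside a common type. The equivalence of the two conditions on
  \<open>\<tau>\<close> forms the first conjunct.\<close>

theorem theorem5p6:
  fixes n :: nat and \<tau> :: "real \<Rightarrow> real \<Rightarrow> real"
    and X :: "nat \<Rightarrow> 'a set" and \<mu> :: "nat \<Rightarrow> 'a \<Rightarrow> 'a \<Rightarrow> real"
  assumes "n \<ge> 1" and "triangular_norm \<tau>"
  shows "(\<not> has_zero_divisors \<tau> \<longleftrightarrow> \<not> (\<exists>a. nilpotent_element \<tau> a)) \<and>
    (\<not> has_zero_divisors \<tau> \<longrightarrow>
      ((\<forall>i\<in>{1..n}. distributive_fuzzy_lattice (X i) (\<mu> i)) \<longrightarrow>
        distributive_fuzzy_lattice (\<Pi>\<^sub>E i\<in>{1..n}. X i) (product_fuzzy_relation \<tau> n \<mu>)) \<and>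
      ((\<forall>i\<in>{1..n}. modular_fuzzy_lattice (X i) (\<mu> i)) \<longrightarrow>
        modular_fuzzy_lattice (\<Pi>\<^sub>E i\<in>{1..n}. X i) (product_fuzzy_relation \<tau> n \<mu>)))"
  using has_zero_divisors_iff_nilpotent_element[OF assms(2)]
    distributive_fuzzy_lattice_product[OF assms(2), of n X \<mu>]
    modular_fuzzy_lattice_product[OF assms(2), of n X \<mu>]
  by blast

end
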